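(* Let $\phi_1,\phi_2,\dots$ and $u$ be indeterminates, $\Phi(z)=1+\phi_1z+\phi_2z^2+\cdots$, and let $Z(u,y)$ be the unique formal power series solution $F=f_1y+f_2y^2+\cdots$ (no constant term) of $F^2\Phi(F)-2yF+(1-u^2)y^2=0$ with $f_1=1-u$. Then for any positive integer $r$, \[Z(u,y)^r=y^r(1-u)^r+\sum_{n=r+1}^\infty y^n\sum_{m_1+2m_2+\cdots=n-r}(-1)^m\frac{r}{2m+n}\binom{m}{m_1,m_2,\dots}P_{m,n}(u)\,\phi_1^{m_1}\phi_2^{m_2}\cdots,\] where the inner sum is over sequences of nonnegative integers $(m_1,m_2,\dots)$ with $m_1+2m_2+\cdots=n-r$, $m=m_1+m_2+\cdots$, and \[P_{m,n}(u)=\sum_{i=1-2m}^{n}\binom{2m+n}{2m+i}\binom{m+i/2}{m}(-u)^i.\]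
   Context: $\binom{a}{m}=a(a-1)\cdots(a-m+1)/m!$ for rational $a$ and nonnegative integer $m$; $\binom{m}{m_1,m_2,\dots}$ is the multinomial coefficient. *)

theory Defs
  imports
    "HOL-Library.Poly_Mapping"
    "HOL-Computational_Algebra.Fraction_Field"
    "HOL-Computational_Algebra.Formal_Power_Series"
begin

lemma of_nat_fract: "(of_nat n :: 'a::idom fract) = Fraction_Field.Fract (of_nat n) 1"
  by (induction n) (simp_all add: Fraction_Field.Zero_fract_def Fraction_Field.One_fract_def)

instance fract :: ("{idom, ring_char_0}") field_char_0
proof
  show "inj (of_nat :: nat \<Rightarrow> 'a fract)"
    by (rule injI) (simp add: of_nat_fract Fraction_Field.eq_fract)
qed

text \<open>
  The polynomial ring over the rationals in the countably many indeterminates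
  \<open>u, \<phi>\<^sub>1, \<phi>\<^sub>2, \<dots>\<close> is the type \<open>(nat \<Rightarrow>\<^sub>0 nat) \<Rightarrow>\<^sub>0 rat\<close>, where the indeterminate
  with index 0 is \<open>u\<close> and the one with index \<open>k \<ge> 1\<close> is \<open>\<phi>\<^sub>k\<close>.
  Since the coefficients of \<open>Z(u,y)\<close> involve negative powers of \<open>u\<close>, the coefficient
  domain for power series in \<open>y\<close> is its fraction field.
\<close>

type_synonym coeff_field = "((nat \<Rightarrow>\<^sub>0 nat) \<Rightarrow>\<^sub>0 rat) fract"

definition indet :: "nat \<Rightarrow> coeff_field" where
  "indet k = Fraction_Field.Fract (Poly_Mapping.single (Poly_Mapping.single k 1) 1) 1"

definition u :: coeff_field where
  "u = indet 0"

text \<open>Only \<open>\<phi> k\<close> with \<open>k \<ge> 1\<close> is ever used below.\<close>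

definition \<phi> :: "nat \<Rightarrow> coeff_field" where
  "\<phi> k = indet k"

definition \<Phi> :: "coeff_field fps" where
  "\<Phi> = Abs_fps (\<lambda>k. if k = 0 then 1 else \<phi> k)"

text \<open>
  The series variable \<open>y\<close> is \<open>fps_X\<close>. The composition \<open>\<Phi> oo F\<close> is the substitution \<open>\<Phi>(F)\<close>
  because \<open>F\<close> has no constant term.
\<close>

definition is_Z :: "coeff_field fps \<Rightarrow> bool" where
  "is_Z F \<longleftrightarrow> fps_nth F 0 = 0 \<and> fps_nth F 1 = 1 - u \<and>
     F\<^sup>2 * (\<Phi> oo F) - 2 * fps_X * F + fps_const (1 - u\<^sup>2) * fps_X\<^sup>2 = 0"

definition Z :: "coeff_field fps" where
  "Z = (THE F. is_Z F)"

text \<open>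
  A sequence \<open>(m\<^sub>1, m\<^sub>2, \<dots>)\<close> of nonnegative integers with \<open>m\<^sub>1 + 2 m\<^sub>2 + \<dots> = N\<close> necessarily has
  finite support; it is represented as a finitely supported function that vanishes at index 0.
\<close>

definition exponent_seqs :: "nat \<Rightarrow> (nat \<Rightarrow>\<^sub>0 nat) set" where
  "exponent_seqs N = {\<mu>. Poly_Mapping.lookup \<mu> 0 = 0 \<and> (\<Sum>k\<in>Poly_Mapping.keys \<mu>. k * Poly_Mapping.lookup \<mu> k) = N}"

definition total_count :: "(nat \<Rightarrow>\<^sub>0 nat) \<Rightarrow> nat" where
  "total_count \<mu> = (\<Sum>k\<in>Poly_Mapping.keys \<mu>. Poly_Mapping.lookup \<mu> k)"

definition multinomial :: "(nat \<Rightarrow>\<^sub>0 nat) \<Rightarrow> coeff_field" where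
  "multinomial \<mu> = fact (total_count \<mu>) / (\<Prod>k\<in>Poly_Mapping.keys \<mu>. fact (Poly_Mapping.lookup \<mu> k))"

definition \<phi>_monomial :: "(nat \<Rightarrow>\<^sub>0 nat) \<Rightarrow> coeff_field" where
  "\<phi>_monomial \<mu> = (\<Prod>k\<in>Poly_Mapping.keys \<mu>. \<phi> k ^ Poly_Mapping.lookup \<mu> k)"

text \<open>
  In the summation range \<open>2m + i \<ge> 1\<close>, so the conversion to \<^typ>\<open>nat\<close> does not truncate;
  \<open>i\<close> may be negative, so the power of \<open>-u\<close> has an integer exponent.
\<close>

definition P :: "nat \<Rightarrow> nat \<Rightarrow> coeff_field" where
  "P m n = (\<Sum>i = 1 - 2 * int m .. int n.
     of_nat ((2 * m + n) choose nat (2 * int m + i)) *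
     ((of_nat m + of_int i / 2) gchoose m) * (- u) powi i)"

end

theory Submission
  imports Defs
begin

text \<open>
  Solving the equation for \<open>y\<close> gives \<open>y = F / H(F)\<close>, where \<open>H = h(\<Phi> - 1)\<close> and \<open>h(t)\<close> satisfies
  \<open>(1 - h)\<^sup>2 = u\<^sup>2 - t h\<^sup>2\<close>. Lagrange inversion expresses the coefficients of \<open>Z\<^sup>r\<close> through those of
  \<open>H\<^sup>n\<close>, and the multinomial expansion of \<open>(\<Phi> - 1)\<^sup>m\<close> leaves the coefficients of \<open>h\<^sup>n\<close>.
  For these, write \<open>h = 1 - \<surd>(u\<^sup>2 + s)\<close>; then \<open>s = - t (1 - \<surd>(u\<^sup>2 + s))\<^sup>2\<close>, and a second Lagrange inversion
  reduces the coefficient of \<open>t\<^sup>m\<close> in \<open>h\<^sup>n\<close> to that of \<open>s\<^sup>m\<close> in \<open>(1 - \<surd>(u\<^sup>2 + s))\<^bsup>2m + n\<^esup>\<close>, which is \<open>P\<^bsub>m,n\<^esub>(u)\<close>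
  by the binomial theorem.
\<close>

unbundle fps_syntax

subsection \<open>Lagrange inversion\<close>

text \<open>
  With \<open>K = X L\<close>, the left-hand side is the residue of \<open>j K\<^bsup>j - 1 - n\<^esup> K'\<close>. For \<open>j \<noteq> n\<close> this is, up to a
  factor, the derivative of \<open>K\<^bsup>j - n\<^esup>\<close>, so its residue vanishes.
\<close>

lemma lagrange_residue:
  fixes L :: "'a::field_char_0 fps"
  assumes L0: "L $ 0 \<noteq> 0" and n: "n > 0"
  shows "(fps_deriv ((fps_X * L) ^ j) * inverse L ^ n) $ (n - 1) = (if j = n then of_nat n else 0)"
proof (cases "j = 0")
  case True
  then show ?thesis using n by simp
next
  case False
  define H where "H = inverse L"
  have LH: "L * H = 1"
    unfolding H_def using L0 by (rule inverse_mult_eq_1')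
  have LHp: "L ^ i * H ^ i = 1" for i
    by (simp add: LH flip: power_mult_distrib)
  have dH: "fps_deriv H = - fps_deriv L * H\<^sup>2"
    unfolding H_def using L0 by (rule fps_inverse_deriv)
  have dK: "fps_deriv ((fps_X * L) ^ j) =
      fps_const (of_nat j) * fps_X ^ (j - 1) * (L ^ (j - 1) * (L + fps_X * fps_deriv L))"
    unfolding fps_deriv_power by (simp add: power_mult_distrib algebra_simps)
  consider "j < n" | "j = n" | "j > n" by linarith
  then show ?thesis
  proof cases
    case 1
    define k where "k = n - j"
    have k: "k > 0" "n = (j - 1) + Suc k" using 1 False by (auto simp: k_def)
    have nk: "n - 1 = (j - 1) + k" using k(2) by simp
    have "L ^ (j - 1) * (L + fps_X * fps_deriv L) * H ^ n
        = (L ^ (j - 1) * H ^ (j - 1)) * ((L * H) * H ^ k + fps_X * fps_deriv L * H ^ Suc k)"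
      unfolding k(2) power_add by (simp add: algebra_simps)
    also have "\<dots> = H ^ k + fps_X * fps_deriv L * H ^ Suc k"
      by (simp add: LH LHp)
    finally have e: "fps_deriv ((fps_X * L) ^ j) * H ^ n =
        fps_const (of_nat j) * (fps_X ^ (j - 1) * (H ^ k + fps_X * fps_deriv L * H ^ Suc k))"
      unfolding dK by (simp add: mult.assoc)
    \<comment> \<open>Splitting off \<open>H\<^sup>2\<close> matches \<open>dH\<close>, so k X L'
      H^(k+1) = - X (H^k)'. Its coefficient at k is - k (H^k) $ k, which cancels the contribution of
      the summand \<open>H ^ k\<close>.\<close>
    have "H ^ Suc k = H\<^sup>2 * H ^ (k - 1)"
      using k(1) by (cases k) (simp_all add: power2_eq_square)
    then have "fps_const (of_nat k) * (fps_X * fps_deriv L * H ^ Suc k) = - fps_X * fps_deriv (H ^ k)"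
      unfolding fps_deriv_power dH by (simp add: algebra_simps)
    then have "(fps_const (of_nat k) * (fps_X * fps_deriv L * H ^ Suc k)) $ k
        = (- fps_X * fps_deriv (H ^ k)) $ k" by (rule arg_cong)
    also have "\<dots> = - of_nat k * (H ^ k) $ k"
      using k(1) by (simp add: mult.assoc del: fps_deriv_power)
    finally have "of_nat k * (H ^ k + fps_X * fps_deriv L * H ^ Suc k) $ k = 0"
      unfolding fps_mult_left_const_nth fps_add_nth distrib_left
      by (simp only: mult_minus_left add.right_inverse)
    then have "(H ^ k + fps_X * fps_deriv L * H ^ Suc k) $ k = 0"
      using k(1) by (metis mult_eq_0_iff of_nat_eq_0_iff less_irrefl)
    then have "(fps_deriv ((fps_X * L) ^ j) * H ^ n) $ (n - 1) = 0"
      unfolding e nk fps_mult_left_const_nth fps_X_power_mult_nth by simp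
    then show ?thesis using 1 by (simp add: H_def)
  next
    case 2
    have "n = Suc (n - 1)" using n by simp
    then have "L ^ (n - 1) * (L + fps_X * fps_deriv L) * H ^ n
        = (L ^ (n - 1) * H ^ (n - 1)) * (L * H + fps_X * fps_deriv L * H)"
      by (metis (no_types, lifting) distrib_left mult.assoc mult.commute power_Suc)
    then have "fps_deriv ((fps_X * L) ^ j) * H ^ n =
        fps_const (of_nat n) * (fps_X ^ (n - 1) * (1 + fps_X * fps_deriv L * H))"
      unfolding dK by (simp add: 2 LH LHp mult.assoc)
    then have "(fps_deriv ((fps_X * L) ^ j) * H ^ n) $ (n - 1) = of_nat n"
      by (simp add: mult.assoc fps_X_power_mult_nth)
    then show ?thesis using 2 by (simp add: H_def)
  next
    case 3
    \<comment> \<open>The derivative is divisible by X^(j - 1), and j - 1 > n - 1.\<close>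
    then show ?thesis using n unfolding dK
      by (simp add: mult.assoc fps_X_power_mult_nth)
  qed
qed

text \<open>Put K = X L and let a be the composition of g with the inverse of K. Then g is the sum
  of the a_j K^j; after differentiation and multiplication by L^(-n),
  \<open>lagrange_residue\<close> leaves only n a_n at index n - 1.\<close>

theorem lagrange_inversion:
  fixes L g :: "'a::field_char_0 fps"
  assumes L0: "L $ 0 \<noteq> 0" and n: "n > 0"
  shows "of_nat n * (g oo fps_inv (fps_X * L)) $ n = (fps_deriv g * inverse L ^ n) $ (n - 1)"
proof -
  define K where "K = fps_X * L"
  define a where "a = g oo fps_inv K"
  have K: "K $ 0 = 0" "K $ 1 \<noteq> 0" using L0 by (simp_all add: K_def)
  have F0: "fps_inv K $ 0 = 0" by (simp add: fps_inv_def)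
  have "a oo K = g"
    unfolding a_def using K F0
    by (subst fps_compose_assoc [symmetric]) (simp_all add: fps_inv)
  then have g: "g $ i = (\<Sum>j\<le>i. a $ j * (K ^ j) $ i)" for i
    by (auto simp: fps_compose_nth atLeast0AtMost)
  \<comment> \<open>K^j starts at X^j or later, so j <= n suffices for every coefficient up to n. A
    range independent of i allows the double sum to be swapped below.\<close>
  have g': "g $ i = (\<Sum>j\<le>n. a $ j * (K ^ j) $ i)" if "i \<le> n" for i
    unfolding g using that
    by (intro sum.mono_neutral_left) (auto simp: startsby_zero_power_prefix [OF K(1)])
  have dg: "fps_deriv g $ i = (\<Sum>j\<le>n. a $ j * fps_deriv (K ^ j) $ i)" if "i \<le> n - 1" for i
  proof -
    have "i + 1 \<le> n" using that n by simp
    then show ?thesis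
      unfolding fps_deriv_nth g' [OF \<open>i + 1 \<le> n\<close>] by (simp add: sum_distrib_left ac_simps)
  qed
  have "(fps_deriv g * inverse L ^ n) $ (n - 1)
      = (\<Sum>i=0..n-1. (\<Sum>j\<le>n. a $ j * fps_deriv (K ^ j) $ i) * (inverse L ^ n) $ (n - 1 - i))"
    unfolding fps_mult_nth by (intro sum.cong refl) (simp only: dg atLeastAtMost_iff)
  also have "\<dots> = (\<Sum>j\<le>n. a $ j * (fps_deriv (K ^ j) * inverse L ^ n) $ (n - 1))"
    unfolding fps_mult_nth sum_distrib_right sum_distrib_left
    by (subst sum.swap) (simp only: mult.assoc)
  also have "\<dots> = (\<Sum>j\<le>n. if j = n then a $ j * of_nat n else 0)"
    unfolding K_def lagrange_residue [OF L0 n] by (intro sum.cong) auto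
  also have "\<dots> = of_nat n * a $ n" by simp
  finally show ?thesis by (simp add: a_def K_def)
qed

text \<open>Composing X L with F gives F L(F) = X; dividing by L(F) yields the fixed-point form. An
  equation F = X R(F) is thus solved by taking L = 1/R.\<close>

lemma fps_inv_fixpoint:
  fixes L :: "'a::field fps"
  assumes "L $ 0 \<noteq> 0"
  defines "F \<equiv> fps_inv (fps_X * L)"
  shows "F $ 0 = 0" "F = fps_X * (inverse L oo F)"
proof -
  show F0: "F $ 0 = 0" by (simp add: F_def fps_inv_def)
  have "(fps_X * L) oo F = fps_X"
    unfolding F_def by (rule fps_inv_right) (use assms in simp_all)
  then have "F * (L oo F) = fps_X"
    by (simp add: fps_compose_mult_distrib F0)
  moreover have "(L oo F) * (inverse L oo F) = 1"
    using assms F0 by (simp add: fps_inverse_compose inverse_mult_eq_1')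
  ultimately show "F = fps_X * (inverse L oo F)"
    by (metis mult.assoc mult.right_neutral)
qed

subsection \<open>The quadratic equation\<close>

text \<open>For nonzero c this is the square root of c^2 + X with constant term c: factoring out c
  before applying the binomial series fixes the branch.\<close>

definition fps_sqrt_shift :: "'a::field_char_0 \<Rightarrow> 'a fps" where
  "fps_sqrt_shift c = fps_const c * (fps_binomial (1/2) oo (fps_const (1 / c\<^sup>2) * fps_X))"

lemma fps_sqrt_shift_power_nth:
  fixes c :: "'a::field_char_0"
  assumes "c \<noteq> 0"
  shows "(fps_sqrt_shift c ^ j) $ m = (of_nat j / 2 gchoose m) * c powi (int j - 2 * int m)"
proof -
  have "fps_sqrt_shift c ^ j =
      fps_const (c ^ j) * (fps_binomial (of_nat j / 2) oo (fps_const (1 / c\<^sup>2) * fps_X))"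
    unfolding fps_sqrt_shift_def
    by (simp add: power_mult_distrib fps_const_power fps_compose_power fps_binomial_power
        del: fps_compose_linear)
  then have "(fps_sqrt_shift c ^ j) $ m = c ^ j * ((1 / c\<^sup>2) ^ m * (of_nat j / 2 gchoose m))"
    by (simp add: fps_compose_linear)
  moreover have "c ^ j * (1 / c\<^sup>2) ^ m = c powi (int j - 2 * int m)"
    using assms by (simp add: power_int_diff power_one_over power_mult power_int_mult)
  ultimately show ?thesis by (metis mult.assoc mult.commute)
qed

lemma fps_sqrt_shift_nth_0: "c \<noteq> 0 \<Longrightarrow> fps_sqrt_shift c $ 0 = c"
  using fps_sqrt_shift_power_nth [of c 1 0] by simp

lemma fps_sqrt_shift_squared:
  fixes c :: "'a::field_char_0"
  assumes "c \<noteq> 0"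
  shows "(fps_sqrt_shift c)\<^sup>2 = fps_const (c\<^sup>2) + fps_X"
proof (rule fps_ext)
  fix m
  have "((1::'a) gchoose m) = (1 + fps_X :: 'a fps) $ m"
    by (simp flip: fps_binomial_1 fps_binomial_nth)
  then show "((fps_sqrt_shift c)\<^sup>2) $ m = (fps_const (c\<^sup>2) + fps_X) $ m"
    using assms by (cases m) (auto simp: fps_sqrt_shift_power_nth fps_X_def)
qed

text \<open>Trading h for s with 1 - h = q(s), where q is \<open>fps_sqrt_shift c\<close>, turns the
  quadratic into s = X R(s) with R = - (1 - q)^2. As R has constant term - (1 - c)^2, the condition
  c \<noteq> 1 makes it invertible, and Lagrange inversion also yields the coefficients of h^n = (1
  - q)^n o s.\<close>

lemma quadratic_solution_exists:
  fixes c :: "'a::field_char_0"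
  assumes c: "c \<noteq> 0" "c \<noteq> 1"
  obtains h :: "'a fps" where "h $ 0 = 1 - c" "(1 - h)\<^sup>2 = fps_const (c\<^sup>2) - fps_X * h\<^sup>2"
    "\<And>m n. m > 0 \<Longrightarrow> of_nat (2 * m + n) * (h ^ n) $ m =
       (- 1) ^ m * of_nat n * ((1 - fps_sqrt_shift c) ^ (2 * m + n)) $ m"
proof
  define q where "q = fps_sqrt_shift c"
  define R where "R = - ((1 - q)\<^sup>2)"
  define s where "s = fps_inv (fps_X * inverse R)"
  define h where "h = 1 - (q oo s)"
  have q0: "q $ 0 = c" using c by (simp add: q_def fps_sqrt_shift_nth_0)
  have R0: "R $ 0 \<noteq> 0" using c by (simp add: R_def q0)
  have iR: "inverse R $ 0 \<noteq> 0" "inverse (inverse R) = R" using R0 by auto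
  have s0: "s $ 0 = 0" and s: "s = fps_X * (R oo s)"
    using fps_inv_fixpoint [OF iR(1)] unfolding iR(2) by (simp_all add: s_def)
  have hp: "h ^ n = (1 - q) ^ n oo s" for n
    unfolding h_def by (simp add: fps_compose_sub_distrib s0 flip: fps_compose_power)
  show "h $ 0 = 1 - c" by (simp add: h_def q0)
  have "R oo s = - (h\<^sup>2)" by (simp add: R_def hp fps_compose_uminus)
  then have s': "s = - fps_X * h\<^sup>2" using s by simp
  have "(1 - h)\<^sup>2 = q\<^sup>2 oo s" by (simp add: h_def fps_compose_power s0)
  also have "\<dots> = fps_const (c\<^sup>2) + s"
    using c by (simp add: q_def fps_sqrt_shift_squared fps_compose_add_distrib s0)
  finally show "(1 - h)\<^sup>2 = fps_const (c\<^sup>2) - fps_X * h\<^sup>2" using s' by simp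
  fix m n :: nat
  assume m: "m > 0"
  have dpow: "fps_deriv ((1 - q) ^ k) * (1 - q) = fps_const (of_nat k) * (fps_deriv (1 - q) * (1 - q) ^ k)" for k
    unfolding fps_deriv_power by (cases k) (simp_all add: ac_simps del: fps_deriv_sub)
  have q1: "1 - q \<noteq> 0" using R0 by (auto simp: R_def)
  \<comment> \<open>Both derivatives are multiples of (1 - q)' (1 - q)^(2m + n - 1). The extra
    factor 1 - q avoids the exponent n - 1, which would truncate at n = 0.\<close>
  have "(fps_const (of_nat (2 * m + n)) * (fps_deriv ((1 - q) ^ n) * R ^ m)) * (1 - q) =
      (fps_const ((- 1) ^ m * of_nat n) * fps_deriv ((1 - q) ^ (2 * m + n))) * (1 - q)"
  proof -
    have "R ^ m = fps_const ((- 1) ^ m) * (1 - q) ^ (2 * m)"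
      unfolding R_def power_minus [of "(1 - q)\<^sup>2"] power_mult
      by (simp add: fps_const_power [symmetric] fps_const_neg [symmetric] del: fps_const_power fps_const_neg)
    then have "(fps_const (of_nat (2 * m + n)) * (fps_deriv ((1 - q) ^ n) * R ^ m)) * (1 - q) =
      fps_const (of_nat (2 * m + n)) * (fps_const ((- 1) ^ m) * (1 - q) ^ (2 * m)) * (fps_deriv ((1 - q) ^ n) * (1 - q))"
      by (simp only: ac_simps)
    also have "\<dots> = fps_const ((- 1) ^ m) * fps_const (of_nat n) *
       (fps_const (of_nat (2 * m + n)) * (fps_deriv (1 - q) * (1 - q) ^ (2 * m + n)))"
      unfolding dpow power_add by (simp only: ac_simps)
    also have "\<dots> = fps_const ((- 1) ^ m) * fps_const (of_nat n) * (fps_deriv ((1 - q) ^ (2 * m + n)) * (1 - q))"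
      unfolding dpow ..
    finally show ?thesis by (simp only: ac_simps fps_const_mult)
  qed
  then have e: "fps_const (of_nat (2 * m + n)) * (fps_deriv ((1 - q) ^ n) * R ^ m) =
      fps_const ((- 1) ^ m * of_nat n) * fps_deriv ((1 - q) ^ (2 * m + n))"
    using q1 mult_right_cancel by blast
  have "of_nat m * (h ^ n) $ m = (fps_deriv ((1 - q) ^ n) * R ^ m) $ (m - 1)"
    unfolding hp s_def using lagrange_inversion [OF iR(1) m, of "(1 - q) ^ n"] iR(2) by simp
  then have "of_nat m * (of_nat (2 * m + n) * (h ^ n) $ m) =
      (fps_const (of_nat (2 * m + n)) * (fps_deriv ((1 - q) ^ n) * R ^ m)) $ (m - 1)"
    by (metis fps_mult_left_const_nth mult.left_commute)
  also have "\<dots> = of_nat m * ((- 1) ^ m * of_nat n * ((1 - q) ^ (2 * m + n)) $ m)"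
    unfolding e fps_mult_left_const_nth fps_deriv_nth using m by (simp add: ac_simps)
  finally have "of_nat (2 * m + n) * (h ^ n) $ m = (- 1) ^ m * of_nat n * ((1 - q) ^ (2 * m + n)) $ m"
    using m by simp
  then show "of_nat (2 * m + n) * (h ^ n) $ m =
       (- 1) ^ m * of_nat n * ((1 - fps_sqrt_shift c) ^ (2 * m + n)) $ m"
    by (simp add: q_def)
qed

section \<open>Existence and uniqueness for the implicit equation\<close>

text \<open>With H = h(\<Psi> - 1) and F = X H(F), the quadratic for h becomes the equation for F.
  Lagrange inversion applied to X^r gives n [X^n] F^r = r [X^(n-r)] H^n, and H^n expands in powers
  of \<Psi> - 1 with the coefficients of h^n.\<close>

lemma implicit_solution:
  fixes c :: "'a::field_char_0" and \<Psi> :: "'a fps"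
  assumes c: "c \<noteq> 0" "c \<noteq> 1" and \<Psi>: "\<Psi> $ 0 = 1"
  obtains F where "F $ 0 = 0" "F $ 1 = 1 - c"
    "F\<^sup>2 * (\<Psi> oo F) - 2 * fps_X * F + fps_const (1 - c\<^sup>2) * fps_X\<^sup>2 = 0"
    "\<And>r n. r > 0 \<Longrightarrow> r < n \<Longrightarrow> (F ^ r) $ n = (\<Sum>m=1..n - r.
       (- 1) ^ m * (of_nat r / of_nat (2 * m + n)) *
       ((1 - fps_sqrt_shift c) ^ (2 * m + n)) $ m * ((\<Psi> - 1) ^ m) $ (n - r))"
proof -
  obtain h where h: "h $ 0 = 1 - c" "(1 - h)\<^sup>2 = fps_const (c\<^sup>2) - fps_X * h\<^sup>2"
    and hn: "\<And>m n. m > 0 \<Longrightarrow> of_nat (2 * m + n) * (h ^ n) $ m =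
       (- 1) ^ m * of_nat n * ((1 - fps_sqrt_shift c) ^ (2 * m + n)) $ m"
    using quadratic_solution_exists [OF c] by metis
  define \<psi> where "\<psi> = \<Psi> - 1"
  define H where "H = h oo \<psi>"
  define F where "F = fps_inv (fps_X * inverse H)"
  have \<psi>0: "\<psi> $ 0 = 0" by (simp add: \<psi>_def \<Psi>)
  have H0: "H $ 0 = 1 - c" by (simp add: H_def h)
  have iH: "inverse H $ 0 \<noteq> 0" "inverse (inverse H) = H" using H0 c by auto
  have F0: "F $ 0 = 0" and F: "F = fps_X * (H oo F)"
    using fps_inv_fixpoint [OF iH(1)] unfolding iH(2) by (simp_all add: F_def)
  have F1: "F $ 1 = 1 - c" by (subst F) (simp add: H0)
  have "(1 - H)\<^sup>2 = (1 - h)\<^sup>2 oo \<psi>"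
    by (simp add: H_def \<psi>0 fps_compose_sub_distrib flip: fps_compose_power)
  also have "\<dots> = fps_const (c\<^sup>2) - \<psi> * H\<^sup>2"
    unfolding h by (simp add: H_def \<psi>0 fps_compose_sub_distrib fps_compose_mult_distrib fps_compose_power)
  finally have "(1 - H)\<^sup>2 oo F = (fps_const (c\<^sup>2) - \<psi> * H\<^sup>2) oo F" by simp
  then have "(1 - (H oo F))\<^sup>2 = fps_const (c\<^sup>2) - (\<psi> oo F) * (H oo F)\<^sup>2"
    by (simp add: F0 fps_compose_sub_distrib fps_compose_mult_distrib flip: fps_compose_power)
  \<comment> \<open>Multiplying by X^2 lets each H(F) absorb a factor X and become F.\<close>
  then have "(fps_X * (1 - (H oo F)))\<^sup>2 = fps_X\<^sup>2 * fps_const (c\<^sup>2) - (\<psi> oo F) * (fps_X * (H oo F))\<^sup>2"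
    unfolding power_mult_distrib by (simp only: right_diff_distrib ac_simps)
  then have "(fps_X - F)\<^sup>2 = fps_X\<^sup>2 * fps_const (c\<^sup>2) - (\<psi> oo F) * F\<^sup>2"
    by (simp add: right_diff_distrib flip: F)
  moreover have "\<psi> oo F = (\<Psi> oo F) - 1" by (simp add: \<psi>_def fps_compose_sub_distrib)
  ultimately have eq: "F\<^sup>2 * (\<Psi> oo F) - 2 * fps_X * F + fps_const (1 - c\<^sup>2) * fps_X\<^sup>2 = 0"
    by (simp add: power2_eq_square algebra_simps flip: fps_const_sub)
  have "(F ^ r) $ n = (\<Sum>m=1..n - r. (- 1) ^ m * (of_nat r / of_nat (2 * m + n)) *
       ((1 - fps_sqrt_shift c) ^ (2 * m + n)) $ m * ((\<Psi> - 1) ^ m) $ (n - r))"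
    if r: "r > 0" "r < n" for r n
  proof -
    have n: "n > 0" using r by simp
    have "of_nat n * (F ^ r) $ n = (fps_deriv (fps_X ^ r) * H ^ n) $ (n - 1)"
      using lagrange_inversion [OF iH(1) n, of "fps_X ^ r"] F0
      unfolding F_def [symmetric] iH(2) by (simp flip: fps_compose_power)
    also have "\<dots> = (fps_const (of_nat r) * (fps_X ^ (r - 1) * H ^ n)) $ (n - 1)"
      by (simp add: fps_deriv_power mult.assoc)
    also have "\<dots> = of_nat r * (H ^ n) $ (n - r)"
      unfolding fps_mult_left_const_nth fps_X_power_mult_nth using r by simp
    also have "(H ^ n) $ (n - r) = (\<Sum>m=0..n - r. (h ^ n) $ m * (\<psi> ^ m) $ (n - r))"
      by (simp add: H_def fps_compose_power \<psi>0 fps_compose_nth)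
    \<comment> \<open>The term m = 0 vanishes because the series 1 has no coefficient at n - r >
      0.\<close>
    also have "\<dots> = (\<Sum>m=1..n - r. (h ^ n) $ m * (\<psi> ^ m) $ (n - r))"
      using r by (simp add: sum.atLeast_Suc_atMost)
    finally have "(F ^ r) $ n = (\<Sum>m=1..n - r. of_nat r / of_nat n * ((h ^ n) $ m * (\<psi> ^ m) $ (n - r)))"
      unfolding sum_distrib_left [symmetric] using n by (simp add: field_simps)
    also have "\<dots> = (\<Sum>m=1..n - r. (- 1) ^ m * (of_nat r / of_nat (2 * m + n)) *
       ((1 - fps_sqrt_shift c) ^ (2 * m + n)) $ m * (\<psi> ^ m) $ (n - r))"
    proof (rule sum.cong)
      fix m assume "m \<in> {1..n - r}"
      then have "m > 0" by simp
      \<comment> \<open>The factor n here cancels the 1/n from Lagrange inversion, leaving r / (2m +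
        n).\<close>
      from hn [OF this, of n] have *: "(h ^ n) $ m =
          (- 1) ^ m * of_nat n * ((1 - fps_sqrt_shift c) ^ (2 * m + n)) $ m / of_nat (2 * m + n)"
        using n by (simp add: nonzero_eq_divide_eq mult.commute del: of_nat_add of_nat_mult)
      show "of_nat r / of_nat n * ((h ^ n) $ m * (\<psi> ^ m) $ (n - r)) =
          (- 1) ^ m * (of_nat r / of_nat (2 * m + n)) *
          ((1 - fps_sqrt_shift c) ^ (2 * m + n)) $ m * (\<psi> ^ m) $ (n - r)"
        unfolding * using n by (simp del: of_nat_add of_nat_mult)
    qed simp
    finally show ?thesis by (simp add: \<psi>_def)
  qed
  with F0 F1 eq show ?thesis by (rule that)
qed

lemma fps_power2_eq_imp_eq:
  fixes f g :: "'a::idom fps"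
  assumes "f\<^sup>2 = g\<^sup>2" "f $ 0 \<noteq> - (g $ 0)"
  shows "f = g"
  using assms by (auto simp: power2_eq_iff)

text \<open>
  The equation is quadratic in \<open>y\<close>: it determines the compositional inverse of a solution up to the
  sign of a square root, and the coefficient of \<open>y\<close> fixes that sign.
\<close>

lemma implicit_solution_unique:
  fixes c :: "'a::field_char_0" and \<Psi> :: "'a fps"
  assumes c: "c \<noteq> 0" "c \<noteq> 1" "c \<noteq> - 1"
    and F: "F $ 0 = 0" "F $ 1 = 1 - c"
      "F\<^sup>2 * (\<Psi> oo F) - 2 * fps_X * F + fps_const (1 - c\<^sup>2) * fps_X\<^sup>2 = 0"
    and G: "G $ 0 = 0" "G $ 1 = 1 - c"
      "G\<^sup>2 * (\<Psi> oo G) - 2 * fps_X * G + fps_const (1 - c\<^sup>2) * fps_X\<^sup>2 = 0"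
  shows "F = G"
proof -
  define b where "b = 1 - c\<^sup>2"
  have b: "b = (1 - c) * (1 + c)" by (simp add: b_def power2_eq_square algebra_simps)
  have "1 + c \<noteq> 0" using c(3) by (metis add_eq_0_iff)
  then have b0: "b \<noteq> 0" using c by (simp add: b)
  have root: "\<exists>L. fps_inv F = fps_X * L \<and> (fps_const b * L - 1)\<^sup>2 = 1 - fps_const b * \<Psi> \<and>
      (fps_const b * L - 1) $ 0 = c"
    if F: "F $ 0 = 0" "F $ 1 = 1 - c"
      "F\<^sup>2 * (\<Psi> oo F) - 2 * fps_X * F + fps_const b * fps_X\<^sup>2 = 0" for F
  proof -
    define K where "K = fps_inv F"
    define L where "L = fps_shift 1 K"
    have K0: "K $ 0 = 0" by (simp add: K_def fps_inv_def)
    have FK: "F oo K = fps_X" unfolding K_def by (rule fps_inv_right) (use F c in simp_all)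
    have KL: "K = fps_X * L"
      using K0 by (intro fps_ext) (simp add: L_def)
    have "(F oo K) $ 1 = 1" by (simp add: FK)
    then have K1: "(1 - c) * L $ 0 = 1" by (simp add: fps_compose_nth F(1) F(2) [simplified] KL)
    \<comment> \<open>Substituting the inverse K for X turns F into X and X into K, so \<Psi> is no
      longer composed with the unknown.\<close>
    have "0 = (F\<^sup>2 * (\<Psi> oo F) - 2 * fps_X * F + fps_const b * fps_X\<^sup>2) oo K"
      unfolding F(3) by simp
    also have "\<dots> = (F oo K)\<^sup>2 * ((\<Psi> oo F) oo K) - 2 * K * (F oo K) + fps_const b * K\<^sup>2"
      by (simp add: K0 fps_compose_add_distrib fps_compose_sub_distrib fps_compose_mult_distrib
          numeral_fps_const flip: fps_compose_power)
    also have "(\<Psi> oo F) oo K = \<Psi>"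
      using fps_compose_assoc [OF K0 F(1), of \<Psi>] by (simp add: FK)
    finally have "fps_X\<^sup>2 * \<Psi> - 2 * K * fps_X + fps_const b * K\<^sup>2 = 0"
      by (simp add: FK)
    then have "fps_X\<^sup>2 * (\<Psi> - 2 * L + fps_const b * L\<^sup>2) = 0"
      unfolding KL by (simp add: power2_eq_square algebra_simps)
    \<comment> \<open>Multiplication by b completes the square in b L.\<close>
    then have "fps_const b * (\<Psi> - 2 * L + fps_const b * L\<^sup>2) = 0" by simp
    then have "(fps_const b * L - 1)\<^sup>2 = 1 - fps_const b * \<Psi>"
      by (simp add: power2_eq_square algebra_simps)
    \<comment> \<open>L has constant term 1 / (1 - c) and b = (1 - c) (1 + c), so b L - 1 has
      constant term c.\<close>
    moreover have "b * L $ 0 = 1 + c"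
      using K1 unfolding b by (metis mult.assoc mult.commute mult.right_neutral)
    ultimately show ?thesis
      by (intro exI [of _ L]) (simp add: KL [unfolded K_def])
  qed
  obtain L where L: "fps_inv F = fps_X * L" "(fps_const b * L - 1)\<^sup>2 = 1 - fps_const b * \<Psi>"
    "(fps_const b * L - 1) $ 0 = c"
    using root [OF F [folded b_def]] by blast
  obtain M where M: "fps_inv G = fps_X * M" "(fps_const b * M - 1)\<^sup>2 = 1 - fps_const b * \<Psi>"
    "(fps_const b * M - 1) $ 0 = c"
    using root [OF G [folded b_def]] by blast
  \<comment> \<open>The two roots share the constant term c, so in characteristic 0 they cannot be
    opposite.\<close>
  have "c \<noteq> - c"
    using c(1) by (simp add: eq_neg_iff_add_eq_0 flip: mult_2)
  have "fps_const b * L - 1 = fps_const b * M - 1"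
  proof (rule fps_power2_eq_imp_eq)
    show "(fps_const b * L - 1)\<^sup>2 = (fps_const b * M - 1)\<^sup>2" unfolding L(2) M(2) ..
    show "(fps_const b * L - 1) $ 0 \<noteq> - ((fps_const b * M - 1) $ 0)"
      unfolding L(3) M(3) by (rule \<open>c \<noteq> - c\<close>)
  qed
  then have "fps_inv F = fps_inv G" using L(1) M(1) b0 by simp
  then have "fps_inv (fps_inv F) = fps_inv (fps_inv G)" by simp
  then show ?thesis using F G c by (simp add: fps_inv_idempotent)
qed

subsection \<open>Multinomial expansion\<close>

lemma lookup_le_of_exponent_seqs:
  assumes "\<mu> \<in> exponent_seqs N"
  shows "k * Poly_Mapping.lookup \<mu> k \<le> N"
proof (cases "k \<in> Poly_Mapping.keys \<mu>")
  case True
  then have "k * Poly_Mapping.lookup \<mu> k \<le> (\<Sum>k\<in>Poly_Mapping.keys \<mu>. k * Poly_Mapping.lookup \<mu> k)"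
    by (intro member_le_sum) simp_all
  then show ?thesis using assms by (simp add: exponent_seqs_def)
qed (simp add: in_keys_iff)

lemma finite_exponent_seqs: "finite (exponent_seqs N)"
proof (rule finite_imageD)
  have "Poly_Mapping.lookup ` exponent_seqs N \<subseteq>
      {f. \<forall>k. (k \<in> {..N} \<longrightarrow> f k \<in> {..N}) \<and> (k \<notin> {..N} \<longrightarrow> f k = 0)}"
  proof (intro subsetI, elim imageE, intro CollectI allI conjI impI)
    fix f \<mu> k
    assume f: "f = Poly_Mapping.lookup \<mu>" and \<mu>: "\<mu> \<in> exponent_seqs N"
    \<comment> \<open>The value at index 0 has weight 0, so the weighted sum does not bound
      it.\<close>
    have 0: "f 0 = 0" using \<mu> by (simp add: f exponent_seqs_def)
    have le: "k * f k \<le> N" unfolding f using \<mu> by (rule lookup_le_of_exponent_seqs)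
    show "f k \<in> {..N}" using le 0 by (cases k) auto
    show "f k = 0" if "k \<notin> {..N}" using le that by (cases "f k") auto
  qed
  then show "finite (Poly_Mapping.lookup ` exponent_seqs N)"
    by (rule finite_subset) (rule finite_set_of_finite_funs, simp_all)
  show "inj_on Poly_Mapping.lookup (exponent_seqs N)"
    by (auto intro: inj_onI poly_mapping_eqI)
qed

lemma total_count_le:
  assumes "\<mu> \<in> exponent_seqs N"
  shows "total_count \<mu> \<le> N"
proof -
  have "total_count \<mu> \<le> (\<Sum>k\<in>Poly_Mapping.keys \<mu>. k * Poly_Mapping.lookup \<mu> k)"
    unfolding total_count_def
  proof (rule sum_mono)
    fix k assume "k \<in> Poly_Mapping.keys \<mu>"
    then have "k \<noteq> 0" using assms by (cases k) (auto simp: exponent_seqs_def in_keys_iff)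
    then show "Poly_Mapping.lookup \<mu> k \<le> k * Poly_Mapping.lookup \<mu> k" by simp
  qed
  then show ?thesis using assms by (simp add: exponent_seqs_def)
qed

lemma total_count_eq_0_iff: "total_count \<mu> = 0 \<longleftrightarrow> \<mu> = 0"
  unfolding total_count_def by (auto simp: in_keys_iff intro: poly_mapping_eqI)

lemma keys_add_single:
  "Poly_Mapping.keys (\<nu> + Poly_Mapping.single k (1::nat)) = insert k (Poly_Mapping.keys \<nu>)"
  by (auto simp: in_keys_iff lookup_add lookup_single when_def split: if_splits)

text \<open>Arbitrary weights serve two purposes: w = 1 gives the total count, w j = j the weighted
  degree.\<close>

lemma sum_add_single:
  fixes w :: "nat \<Rightarrow> nat"
  shows "(\<Sum>j\<in>Poly_Mapping.keys (\<nu> + Poly_Mapping.single k 1).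
      w j * Poly_Mapping.lookup (\<nu> + Poly_Mapping.single k 1) j) =
    w k + (\<Sum>j\<in>Poly_Mapping.keys \<nu>. w j * Poly_Mapping.lookup \<nu> j)"
proof -
  let ?S = "insert k (Poly_Mapping.keys \<nu>)"
  have "(\<Sum>j\<in>?S. w j * Poly_Mapping.lookup (\<nu> + Poly_Mapping.single k 1) j) =
      (\<Sum>j\<in>?S. w j * Poly_Mapping.lookup \<nu> j) + (\<Sum>j\<in>?S. if j = k then w j else 0)"
    unfolding sum.distrib [symmetric]
    by (intro sum.cong refl) (auto simp: lookup_add lookup_single when_def algebra_simps)
  also have "(\<Sum>j\<in>?S. w j * Poly_Mapping.lookup \<nu> j) =
      (\<Sum>j\<in>Poly_Mapping.keys \<nu>. w j * Poly_Mapping.lookup \<nu> j)"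
    by (intro sum.mono_neutral_right) (auto simp: in_keys_iff)
  finally show ?thesis unfolding keys_add_single by (simp del: sum.insert_if)
qed

lemma total_count_add_single: "total_count (\<nu> + Poly_Mapping.single k 1) = Suc (total_count \<nu>)"
  using sum_add_single [of "\<lambda>_. 1" \<nu> k] by (simp add: total_count_def)

lemma exponent_seqs_add_single_iff:
  assumes "k > 0"
  shows "\<nu> + Poly_Mapping.single k 1 \<in> exponent_seqs N \<longleftrightarrow> k \<le> N \<and> \<nu> \<in> exponent_seqs (N - k)"
  using assms unfolding exponent_seqs_def mem_Collect_eq sum_add_single [of "\<lambda>j. j"]
  by (auto simp: lookup_add lookup_single)

lemma \<phi>_monomial_add_single:
  "\<phi>_monomial (\<nu> + Poly_Mapping.single k 1) = \<phi> k * \<phi>_monomial \<nu>"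
proof -
  let ?S = "insert k (Poly_Mapping.keys \<nu>)"
  have "\<phi>_monomial (\<nu> + Poly_Mapping.single k 1) =
      (\<Prod>j\<in>?S. (if j = k then \<phi> j else 1) * \<phi> j ^ Poly_Mapping.lookup \<nu> j)"
    unfolding \<phi>_monomial_def keys_add_single
    by (intro prod.cong refl) (auto simp: lookup_add lookup_single when_def)
  also have "\<dots> = \<phi> k * (\<Prod>j\<in>?S. \<phi> j ^ Poly_Mapping.lookup \<nu> j)"
    unfolding prod.distrib by (subst prod.delta) auto
  also have "(\<Prod>j\<in>?S. \<phi> j ^ Poly_Mapping.lookup \<nu> j) = \<phi>_monomial \<nu>"
    unfolding \<phi>_monomial_def by (intro prod.mono_neutral_right) (auto simp: in_keys_iff)
  finally show ?thesis .
qed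

text \<open>Removing one copy of k divides the numerator factorial by the total count of \<mu> and
  the denominator by the multiplicity of k. These ratios sum to 1 over the keys of \<mu>, which is
  the multinomial recurrence.\<close>

lemma multinomial_add_single:
  fixes \<nu> :: "nat \<Rightarrow>\<^sub>0 nat" and k :: nat
  defines "\<mu> \<equiv> \<nu> + Poly_Mapping.single k 1"
  shows "multinomial \<nu> = of_nat (Poly_Mapping.lookup \<mu> k) / of_nat (total_count \<mu>) * multinomial \<mu>"
proof -
  let ?S = "insert k (Poly_Mapping.keys \<nu>)"
  have "(\<Prod>j\<in>Poly_Mapping.keys \<mu>. fact (Poly_Mapping.lookup \<mu> j) :: coeff_field) =
      (\<Prod>j\<in>?S. (if j = k then of_nat (Poly_Mapping.lookup \<mu> k) else 1) * fact (Poly_Mapping.lookup \<nu> j))"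
    unfolding \<mu>_def keys_add_single
    by (intro prod.cong refl) (auto simp: lookup_add lookup_single when_def)
  also have "\<dots> = of_nat (Poly_Mapping.lookup \<mu> k) * (\<Prod>j\<in>?S. fact (Poly_Mapping.lookup \<nu> j))"
    unfolding prod.distrib by (subst prod.delta) auto
  also have "(\<Prod>j\<in>?S. fact (Poly_Mapping.lookup \<nu> j) :: coeff_field) =
      (\<Prod>j\<in>Poly_Mapping.keys \<nu>. fact (Poly_Mapping.lookup \<nu> j))"
    by (intro prod.mono_neutral_right) (auto simp: in_keys_iff)
  finally have p: "(\<Prod>j\<in>Poly_Mapping.keys \<mu>. fact (Poly_Mapping.lookup \<mu> j) :: coeff_field) =
      of_nat (Poly_Mapping.lookup \<mu> k) * (\<Prod>j\<in>Poly_Mapping.keys \<nu>. fact (Poly_Mapping.lookup \<nu> j))" .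
  have t: "total_count \<mu> = Suc (total_count \<nu>)" unfolding \<mu>_def by (rule total_count_add_single)
  have "Poly_Mapping.lookup \<mu> k \<noteq> 0" by (simp add: \<mu>_def lookup_add)
  then show ?thesis
    unfolding multinomial_def p t by (simp del: of_nat_Suc)
qed

text \<open>One more factor \<Phi> - 1 contributes a choice of k. Pairs (k, \<nu>) correspond to
  pairs of \<mu> = \<nu> + e_k and a key k of \<mu>; the weights of the latter add up to 1 for each
  \<mu>.\<close>

lemma fps_power_nth_multinomial:
  "((\<Phi> - 1) ^ m) $ N =
     (\<Sum>\<mu>\<in>{\<mu> \<in> exponent_seqs N. total_count \<mu> = m}. multinomial \<mu> * \<phi>_monomial \<mu>)"
proof (induction m arbitrary: N)
  case 0
  have "{\<mu> \<in> exponent_seqs N. total_count \<mu> = 0} = (if N = 0 then {0} else {})"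
    by (auto simp: total_count_eq_0_iff exponent_seqs_def)
  then show ?case
    by (simp add: multinomial_def \<phi>_monomial_def total_count_def)
next
  case (Suc m)
  define T where "T = (\<lambda>m N. {\<mu> \<in> exponent_seqs N. total_count \<mu> = m})"
  define w where "w = (\<lambda>\<mu>. multinomial \<mu> * \<phi>_monomial \<mu>)"
  let ?e = "\<lambda>k. Poly_Mapping.single k (1::nat)"
  have fin: "finite (T m N)" for m N
    by (simp add: T_def finite_exponent_seqs)
  have "((\<Phi> - 1) ^ Suc m) $ N = (\<Sum>k=0..N. (\<Phi> - 1) $ k * ((\<Phi> - 1) ^ m) $ (N - k))"
    by (simp add: fps_mult_nth)
  \<comment> \<open>The series \<Phi> - 1 has no constant term, so k = 0 drops out.\<close>
  also have "\<dots> = (\<Sum>k=1..N. \<phi> k * (\<Sum>\<nu>\<in>T m (N - k). w \<nu>))"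
    unfolding Suc.IH by (subst sum.atLeast_Suc_atMost) (simp_all add: \<Phi>_def T_def w_def)
  also have "\<dots> = (\<Sum>(k, \<nu>)\<in>Sigma {1..N} (\<lambda>k. T m (N - k)). \<phi> k * w \<nu>)"
    by (simp add: sum_distrib_left sum.Sigma fin)
  also have "\<dots> = (\<Sum>(\<mu>, k)\<in>Sigma (T (Suc m) N) Poly_Mapping.keys.
      of_nat (Poly_Mapping.lookup \<mu> k) / of_nat (Suc m) * w \<mu>)"
  proof (rule sum.reindex_bij_witness
      [where j = "\<lambda>(k, \<nu>). (\<nu> + ?e k, k)" and i = "\<lambda>(\<mu>, k). (k, \<mu> - ?e k)"])
    fix x assume "x \<in> Sigma {1..N} (\<lambda>k. T m (N - k))"
    then obtain k \<nu> where x: "x = (k, \<nu>)" and k: "k \<in> {1..N}" and \<nu>: "\<nu> \<in> T m (N - k)"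
      by blast
    show "(case case x of (k, \<nu>) \<Rightarrow> (\<nu> + ?e k, k) of (\<mu>, k) \<Rightarrow> (k, \<mu> - ?e k)) = x"
      by (simp add: x)
    show "(case x of (k, \<nu>) \<Rightarrow> (\<nu> + ?e k, k)) \<in> Sigma (T (Suc m) N) Poly_Mapping.keys"
      unfolding x using k \<nu> exponent_seqs_add_single_iff [of k \<nu> N] total_count_add_single [of \<nu> k]
        keys_add_single [of \<nu> k]
      by (simp add: T_def)
    have "total_count (\<nu> + ?e k) = Suc m"
      using \<nu> total_count_add_single [of \<nu> k] by (simp add: T_def)
    then show "(case case x of (k, \<nu>) \<Rightarrow> (\<nu> + ?e k, k) of (\<mu>, k) \<Rightarrow>
        of_nat (Poly_Mapping.lookup \<mu> k) / of_nat (Suc m) * w \<mu>) = (case x of (k, \<nu>) \<Rightarrow> \<phi> k * w \<nu>)"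
      unfolding x using multinomial_add_single [of \<nu> k] \<phi>_monomial_add_single [of \<nu> k]
      by (simp add: w_def ac_simps del: of_nat_Suc)
  next
    fix x assume "x \<in> Sigma (T (Suc m) N) Poly_Mapping.keys"
    then obtain \<mu> k where x: "x = (\<mu>, k)"
      and \<mu>: "\<mu> \<in> T (Suc m) N" and k: "k \<in> Poly_Mapping.keys \<mu>"
      by blast
    \<comment> \<open>Subtraction is truncated, but k is a key, so its multiplicity is at least
      1.\<close>
    have e: "(\<mu> - ?e k) + ?e k = \<mu>"
      using k by (intro poly_mapping_eqI)
        (auto simp: lookup_add lookup_minus lookup_single when_def in_keys_iff)
    show "(case case x of (\<mu>, k) \<Rightarrow> (k, \<mu> - ?e k) of (k, \<nu>) \<Rightarrow> (\<nu> + ?e k, k)) = x"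
      using e by (simp add: x)
    have "k > 0" using \<mu> k by (cases k) (auto simp: T_def exponent_seqs_def in_keys_iff)
    then show "(case x of (\<mu>, k) \<Rightarrow> (k, \<mu> - ?e k)) \<in> Sigma {1..N} (\<lambda>k. T m (N - k))"
      using \<mu> exponent_seqs_add_single_iff [of k "\<mu> - ?e k" N] total_count_add_single [of "\<mu> - ?e k" k]
      unfolding e x by (simp add: T_def)
  qed
  also have "\<dots> = (\<Sum>\<mu>\<in>T (Suc m) N. \<Sum>k\<in>Poly_Mapping.keys \<mu>.
      of_nat (Poly_Mapping.lookup \<mu> k) / of_nat (Suc m) * w \<mu>)"
    by (simp add: sum.Sigma fin)
  also have "\<dots> = (\<Sum>\<mu>\<in>T (Suc m) N. w \<mu>)"
  proof (rule sum.cong [OF refl])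
    fix \<mu> assume "\<mu> \<in> T (Suc m) N"
    then have "(\<Sum>k\<in>Poly_Mapping.keys \<mu>. of_nat (Poly_Mapping.lookup \<mu> k)) = (of_nat (Suc m) :: coeff_field)"
      by (simp add: T_def total_count_def flip: of_nat_sum)
    then show "(\<Sum>k\<in>Poly_Mapping.keys \<mu>. of_nat (Poly_Mapping.lookup \<mu> k) / of_nat (Suc m) * w \<mu>) = w \<mu>"
      by (simp del: of_nat_Suc flip: sum_distrib_right sum_divide_distrib)
  qed
  finally show ?case by (simp add: T_def w_def)
qed

section \<open>Specialisation to \<open>c = u\<close> and the final formula\<close>

text \<open>The coefficient of the monomial u is 1 in u and 0 in every constant.\<close>

lemma u_neq: "u \<noteq> 0" "u \<noteq> 1" "u \<noteq> - 1"
proof -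
  define p :: "(nat \<Rightarrow>\<^sub>0 nat) \<Rightarrow>\<^sub>0 rat" where "p = Poly_Mapping.single (Poly_Mapping.single 0 1) 1"
  have u: "u = Fraction_Field.Fract p 1" by (simp add: u_def indet_def p_def)
  have p: "Poly_Mapping.lookup p (Poly_Mapping.single 0 1) = 1" by (simp add: p_def)
  have "Poly_Mapping.lookup (Poly_Mapping.single (0::nat) (1::nat)) 0 \<noteq> Poly_Mapping.lookup 0 0" by simp
  then have ne: "Poly_Mapping.single (0::nat) (1::nat) \<noteq> 0" by metis
  have "p \<noteq> 0" using p by auto
  moreover have "p \<noteq> 1" using p ne by (auto simp: lookup_one when_def)
  moreover have "p \<noteq> - 1" using p ne by (auto simp: lookup_one when_def)
  ultimately show "u \<noteq> 0" "u \<noteq> 1" "u \<noteq> - 1"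
    unfolding u Fraction_Field.Zero_fract_def Fraction_Field.One_fract_def
    by (simp_all add: Fraction_Field.eq_fract)
qed

text \<open>In the binomial expansion of the power, the index j = 2m + i turns j/2 into m + i/2 and
  the exponent j - 2m of u into i.\<close>

lemma P_eq_fps_nth:
  assumes m: "m > 0"
  shows "((1 - fps_sqrt_shift u) ^ (2 * m + n)) $ m = P m n"
proof -
  define N where "N = 2 * m + n"
  define t where "t = (\<lambda>j. of_nat (N choose j) * ((- 1) ^ j *
    ((of_nat j / 2 gchoose m) * u powi (int j - 2 * int m))))"
  have "(1 - fps_sqrt_shift u) ^ N = (\<Sum>j\<le>N. of_nat (N choose j) * (- fps_sqrt_shift u) ^ j)"
    using binomial_ring [of "- fps_sqrt_shift u" 1 N] by simp
  moreover have "(- fps_sqrt_shift u) ^ j = fps_const ((- 1) ^ j) * fps_sqrt_shift u ^ j" for j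
    by (cases "even j") (simp_all flip: fps_const_neg)
  ultimately have "((1 - fps_sqrt_shift u) ^ N) $ m = (\<Sum>j\<le>N. t j)"
    by (simp add: fps_sum_nth fps_mult_of_nat_nth t_def fps_sqrt_shift_power_nth u_neq(1))
  \<comment> \<open>For j = 0 the factor \<open>0 gchoose m\<close> vanishes since m > 0; hence the
    range of i starts at 1 - 2m.\<close>
  also have "\<dots> = (\<Sum>j=1..N. t j)"
  proof (rule sum.mono_neutral_right)
    show "\<forall>j\<in>{..N} - {1..N}. t j = 0"
      using m by (cases m) (auto simp: t_def not_le Suc_le_eq)
  qed auto
  also have "\<dots> = (\<Sum>i = 1 - 2 * int m .. int n. of_nat (N choose nat (2 * int m + i)) *
     ((of_nat m + of_int i / 2) gchoose m) * (- u) powi i)"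
  proof (rule sum.reindex_bij_witness
      [where j = "\<lambda>j. int j - 2 * int m" and i = "\<lambda>i. nat (2 * int m + i)"])
    fix j assume "j \<in> {1..N}"
    have "(- u) powi (int j - 2 * int m) = (- 1) ^ j * u powi (int j - 2 * int m)"
    proof -
      have "(- u) powi (int j - 2 * int m) = ((- 1) * u) powi (int j - 2 * int m)" by simp
      also have "\<dots> = (- 1) powi (int j - 2 * int m) * u powi (int j - 2 * int m)"
        by (rule power_int_mult_distrib)
      \<comment> \<open>The exponents differ by the even number 2m.\<close>
      also have "(- 1 :: coeff_field) powi (int j - 2 * int m) = (- 1) ^ j"
        by (simp add: power_int_diff power_int_mult)
      finally show ?thesis .
    qed
    moreover have "of_nat m + of_int (int j - 2 * int m) / 2 = (of_nat j / 2 :: coeff_field)"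
      by (simp add: field_simps)
    moreover have "nat (2 * int m + (int j - 2 * int m)) = j" by simp
    ultimately show "of_nat (N choose nat (2 * int m + (int j - 2 * int m))) *
        ((of_nat m + of_int (int j - 2 * int m) / 2) gchoose m) * (- u) powi (int j - 2 * int m) = t j"
      unfolding t_def by (simp only: ac_simps)
  qed (auto simp: N_def)
  finally show ?thesis by (simp add: N_def P_def)
qed

theorem theorem7:
  fixes r :: nat
  assumes "r > 0"
  shows "(\<exists>!F. is_Z F) \<and>
    Z ^ r = fps_X ^ r * fps_const ((1 - u) ^ r) +
      Abs_fps (\<lambda>n. if n \<ge> r + 1 then
        (\<Sum>\<mu>\<in>exponent_seqs (n - r).
          (- 1) ^ total_count \<mu> * (of_nat r / of_nat (2 * total_count \<mu> + n)) *
          multinomial \<mu> * P (total_count \<mu>) n * \<phi>_monomial \<mu>)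
        else 0)"
proof -
  have \<Phi>0: "\<Phi> $ 0 = 1" by (simp add: \<Phi>_def)
  obtain F where F: "F $ 0 = 0" "F $ 1 = 1 - u"
    "F\<^sup>2 * (\<Phi> oo F) - 2 * fps_X * F + fps_const (1 - u\<^sup>2) * fps_X\<^sup>2 = 0"
    and Fr: "\<And>r n. r > 0 \<Longrightarrow> r < n \<Longrightarrow> (F ^ r) $ n = (\<Sum>m=1..n - r.
       (- 1) ^ m * (of_nat r / of_nat (2 * m + n)) *
       ((1 - fps_sqrt_shift u) ^ (2 * m + n)) $ m * ((\<Phi> - 1) ^ m) $ (n - r))"
    by (rule implicit_solution [OF u_neq(1,2) \<Phi>0], rule that, assumption+)
  have ex1: "\<exists>!F. is_Z F"
  proof (rule ex1I)
    show "is_Z F" using F by (simp add: is_Z_def)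
  next
    fix G assume "is_Z G"
    then show "G = F"
      unfolding is_Z_def using implicit_solution_unique [OF u_neq _ _ _ F] by blast
  qed
  moreover have "is_Z F" using F by (simp add: is_Z_def)
  ultimately have Z: "Z = F" unfolding Z_def by (rule the1_equality)
  have coeff: "(F ^ r) $ n = (\<Sum>\<mu>\<in>exponent_seqs (n - r).
      (- 1) ^ total_count \<mu> * (of_nat r / of_nat (2 * total_count \<mu> + n)) *
      multinomial \<mu> * P (total_count \<mu>) n * \<phi>_monomial \<mu>)" (is "_ = sum ?f _")
    if n: "r < n" for n
  proof -
    \<comment> \<open>Grouping by total count needs this range: n > r excludes the zero sequence,
      and every part is at least 1.\<close>
    have "total_count \<mu> \<in> {1..n - r}" if "\<mu> \<in> exponent_seqs (n - r)" for \<mu>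
    proof -
      have "\<mu> \<noteq> 0" using that n by (auto simp: exponent_seqs_def)
      then show ?thesis
        using total_count_le [OF that] total_count_eq_0_iff [of \<mu>] by (simp add: Suc_le_eq)
    qed
    then have "sum ?f (exponent_seqs (n - r)) =
        (\<Sum>m=1..n - r. sum ?f {\<mu> \<in> exponent_seqs (n - r). total_count \<mu> = m})"
      by (intro sum.group [symmetric]) (auto simp: finite_exponent_seqs)
    also have "\<dots> = (F ^ r) $ n"
      unfolding Fr [OF assms n]
    proof (rule sum.cong [OF refl])
      fix m assume "m \<in> {1..n - r}"
      then have "((1 - fps_sqrt_shift u) ^ (2 * m + n)) $ m = P m n"
        by (intro P_eq_fps_nth) simp
      then show "sum ?f {\<mu> \<in> exponent_seqs (n - r). total_count \<mu> = m} =
          (- 1) ^ m * (of_nat r / of_nat (2 * m + n)) *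
          ((1 - fps_sqrt_shift u) ^ (2 * m + n)) $ m * ((\<Phi> - 1) ^ m) $ (n - r)"
        unfolding fps_power_nth_multinomial sum_distrib_left
        by (intro sum.cong) (auto simp del: of_nat_add of_nat_mult)
    qed
    finally show ?thesis by simp
  qed
  \<comment> \<open>Factoring out X shows that F^r starts with (1 - u)^r X^r, which settles the
    coefficients up to r.\<close>
  define G where "G = fps_shift 1 F"
  have "F = fps_X * G" using F(1) by (intro fps_ext) (simp add: G_def)
  then have "F ^ r = fps_X ^ r * G ^ r" by (simp add: power_mult_distrib)
  moreover have "G $ 0 = 1 - u" using F(2) by (simp add: G_def)
  ultimately have low: "(F ^ r) $ n = (if n = r then (1 - u) ^ r else 0)" if "n \<le> r" for n
    using that by (simp add: fps_X_power_mult_nth fps_power_zeroth)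
  show ?thesis
    unfolding Z
  proof (intro conjI ex1 fps_ext)
    fix n
    show "(F ^ r) $ n = (fps_X ^ r * fps_const ((1 - u) ^ r) + Abs_fps (\<lambda>n. if n \<ge> r + 1 then
        (\<Sum>\<mu>\<in>exponent_seqs (n - r).
          (- 1) ^ total_count \<mu> * (of_nat r / of_nat (2 * total_count \<mu> + n)) *
          multinomial \<mu> * P (total_count \<mu>) n * \<phi>_monomial \<mu>)
        else 0)) $ n"
    proof (cases "n \<le> r")
      case True
      then show ?thesis by (auto simp: low fps_X_power_mult_nth)
    next
      case False
      then show ?thesis using coeff [of n] by (simp add: fps_X_power_mult_nth)
    qed
  qed
qed

end
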